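(* For every integer $n\ge 0$ let $\overline{L_n}$ be the $n$-chain link with generating polynomial $\overline{L_n}(x)$, and let $L_n(x)$ be the generating polynomial of the $n$-link $L_n$. Then $$\overline{L_n}(x)=(x+2)\,\overline{L_{n-1}}(x)+L_{n-1}(x)\qquad (n\ge 1),$$ and $\overline{L_n}(x)$ is given by the closed form $$\overline{L_n}(x)=(2x+2)^n+(x^2-1)(x+2)^n\qquad (n\ge 0).$$
   Context: A knot (diagram) means a shadow on the sphere $S^2$: a finite collection of closed curves whose only singularities are finitely many transverse double points, called crossings, with no over/under information, considered up to planar isotopy (several components and crossingless circles are allowed). The unknot $U$ is a single simple closed curve. Each crossing can be split in two ways: remove the crossing and reconnect the four ends in one of the two planar non-crossing ways that join adjacent ends (type $0$ and type $1$ splits). A state of a knot $K$ with $m$ crossings is one of the $2^m$ diagrams obtained by choosing a split at each crossing; it is a disjoint union of simple closed curves (circles), and $|S|$ denotes the number of circles of the state $S$. The generating polynomial of $K$ is $K(x)=\sum_S x^{|S|}$, summed over all $2^m$ states. Consider diagrams in a disc with four boundary ends NW, SW (left) and NE, SE (right). The block for the Hopf link consists of two crossings stacked vertically: the two upper ends of the top crossing are NW and NE, its two lower ends are joined to the two upper ends of the bottom crossing (left to left, right to right), and the two lower ends of the bottom crossing are SW and SE. Put $n$ such blocks side by side, joining the NE and SE ends of each block to the NW and SW ends of the next; for $n=0$ take two disjoint horizontal strands NW–NE and SW–SE. The $n$-link $L_n$ is obtained from this diagram by joining, outside the disc and without crossings, NW to SW and NE to SE: it is a row of $n+1$ circles,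 consecutive ones meeting in two crossings ($L_0=U$). The $n$-chain link $\overline{L_n}$, the closure of $L_n$, is obtained by instead joining, outside the disc by disjoint simple arcs, NW to NE and SW to SE: it is a closed chain of $n$ circles ($\overline{L_0}$ is two disjoint circles). *)

theory Defs
  imports "HOL-Computational_Algebra.Polynomial"
begin

section \<open>Shadows, states and the generating polynomial\<close>

text \<open>
  A shadow is encoded as a planar diagram code. The labels name the arcs of the diagram; a
  crossing lists the labels of its four ends in their cyclic (anticlockwise) order around the
  double point, and a joint \<open>(a, b)\<close> is a crossing-free point at which an end of the arc \<open>a\<close> is
  glued to an end of the arc \<open>b\<close>. A crossingless circle is an arc \<open>a\<close> with the joint \<open>(a, a)\<close>.
  Repeated entries are meaningful, hence lists rather than sets. The type does not enforce that
  the code is realised on the sphere (rather than on a surface of higher genus); states and the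
  generating polynomial depend on the cyclic orders only.
\<close>

datatype 'a crossing = Crossing 'a 'a 'a 'a

record 'a diagram =
  crossings :: "'a crossing list"
  joints :: "('a \<times> 'a) list"

fun crossing_ends :: "'a crossing \<Rightarrow> 'a list" where
  "crossing_ends (Crossing a b c d) = [a, b, c, d]"

fun joint_ends :: "'a \<times> 'a \<Rightarrow> 'a list" where
  "joint_ends (a, b) = [a, b]"

definition diagram_ends :: "'a diagram \<Rightarrow> 'a list" where
  "diagram_ends D =
     concat (map crossing_ends (crossings D)) @ concat (map joint_ends (joints D))"

text \<open>Every arc has two ends, so a diagram without loose ends uses each label exactly twice.\<close>

definition closed_diagram :: "'a diagram \<Rightarrow> bool" where
  "closed_diagram D \<longleftrightarrow> (\<forall>a \<in> set (diagram_ends D). count_list (diagram_ends D) a = 2)"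

datatype split_type = Split0 | Split1

text \<open>
  The two planar reconnections of cyclically adjacent ends. A shadow does not distinguish them
  intrinsically; which one is called type 0 depends on the end listed first, and does not affect
  the sum over all states.
\<close>

fun split_crossing :: "split_type \<Rightarrow> 'a crossing \<Rightarrow> ('a \<times> 'a) list" where
  "split_crossing Split0 (Crossing a b c d) = [(a, b), (c, d)]"
| "split_crossing Split1 (Crossing a b c d) = [(b, c), (d, a)]"

definition states :: "'a diagram \<Rightarrow> split_type list set" where
  "states D = {s. length s = length (crossings D)}"

definition state_diagram :: "'a diagram \<Rightarrow> split_type list \<Rightarrow> 'a diagram" where
  "state_diagram D s =
     \<lparr>crossings = [], joints = joints D @ concat (map2 split_crossing s (crossings D))\<rparr>"

text \<open>
  For a closed diagram without crossings, the arcs and joints form a disjoint union of simple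
  closed curves; these are the classes of arcs under the equivalence generated by the joints.
\<close>

definition connected_arcs :: "'a diagram \<Rightarrow> ('a \<times> 'a) set" where
  "connected_arcs D = (set (joints D) \<union> (set (joints D))\<inverse>)\<^sup>*"

definition num_circles :: "'a diagram \<Rightarrow> nat" where
  "num_circles D = card ((\<lambda>a. connected_arcs D `` {a}) ` set (diagram_ends D))"

definition gen_poly :: "'a diagram \<Rightarrow> int poly" where
  "gen_poly D = (\<Sum>s \<in> states D. monom 1 (num_circles (state_diagram D s)))"

abbreviation X :: "int poly" where
  "X \<equiv> [:0, 1:]"


section \<open>Diagrams in a disc with four boundary ends\<close>

text \<open>The fields \<open>nw\<close>, \<open>ne\<close>, \<open>sw\<close>, \<open>se\<close> name the arcs that end at the four boundary points.\<close>

record 'a tangle = "'a diagram" +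
  nw :: 'a
  ne :: 'a
  sw :: 'a
  se :: 'a

definition vertical_closure :: "'a tangle \<Rightarrow> 'a diagram" where
  "vertical_closure T =
     \<lparr>crossings = crossings T, joints = joints T @ [(nw T, sw T), (ne T, se T)]\<rparr>"

definition horizontal_closure :: "'a tangle \<Rightarrow> 'a diagram" where
  "horizontal_closure T =
     \<lparr>crossings = crossings T, joints = joints T @ [(nw T, ne T), (sw T, se T)]\<rparr>"

text \<open>
  Block number \<open>k\<close> has boundary ends NW = \<open>Top k\<close>, SW = \<open>Bot k\<close>, NE = \<open>Top (k + 1)\<close>,
  SE = \<open>Bot (k + 1)\<close>, so that consecutive blocks are joined by sharing labels. The arcs
  \<open>Lft k\<close> and \<open>Rgt k\<close> join its upper crossing to its lower crossing:

  \<^verbatim>\<open>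
    Top k         Top (k+1)
         \       /
          crossing
         /       \
     Lft k       Rgt k
         \       /
          crossing
         /       \
    Bot k         Bot (k+1)
  \<close>
\<close>

datatype arc = Top nat | Bot nat | Lft nat | Rgt nat

definition hopf_block :: "nat \<Rightarrow> arc crossing list" where
  "hopf_block k =
     [Crossing (Top k) (Lft k) (Rgt k) (Top (Suc k)),
      Crossing (Lft k) (Bot k) (Bot (Suc k)) (Rgt k)]"

text \<open>For \<open>n = 0\<close> this is the pair of horizontal strands \<open>Top 0\<close> and \<open>Bot 0\<close>.\<close>

definition block_row :: "nat \<Rightarrow> arc tangle" where
  "block_row n =
     \<lparr>crossings = concat (map hopf_block [0..<n]), joints = [],
      nw = Top 0, ne = Top n, sw = Bot 0, se = Bot n\<rparr>"

definition n_link :: "nat \<Rightarrow> arc diagram" where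
  "n_link n = vertical_closure (block_row n)"

definition chain_link :: "nat \<Rightarrow> arc diagram" where
  "chain_link n = horizontal_closure (block_row n)"

lemma count_row_ends:
  "count_list (concat (map crossing_ends (concat (map hopf_block [0..<n])))) a =
     (case a of
        Top j \<Rightarrow> of_bool (j < n) + of_bool (0 < j \<and> j \<le> n)
      | Bot j \<Rightarrow> of_bool (j < n) + of_bool (0 < j \<and> j \<le> n)
      | Lft j \<Rightarrow> 2 * of_bool (j < n)
      | Rgt j \<Rightarrow> 2 * of_bool (j < n))"
  by (induction n) (auto simp: hopf_block_def split: arc.splits)

lemma closed_n_link: "closed_diagram (n_link n)"
  unfolding closed_diagram_def
proof
  fix a assume a: "a \<in> set (diagram_ends (n_link n))"
  then have "count_list (diagram_ends (n_link n)) a \<noteq> 0"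
    by (simp add: count_list_0_iff)
  then show "count_list (diagram_ends (n_link n)) a = 2"
    by (cases a)
      (auto simp: diagram_ends_def n_link_def vertical_closure_def block_row_def count_row_ends
        split: if_splits)
qed

lemma closed_chain_link: "closed_diagram (chain_link n)"
  unfolding closed_diagram_def
proof
  fix a assume a: "a \<in> set (diagram_ends (chain_link n))"
  then have "count_list (diagram_ends (chain_link n)) a \<noteq> 0"
    by (simp add: count_list_0_iff)
  then show "count_list (diagram_ends (chain_link n)) a = 2"
    by (cases a)
      (auto simp: diagram_ends_def chain_link_def horizontal_closure_def block_row_def
        count_row_ends split: if_splits)
qed

end

theory Submission
  imports Defs
begin

text \<open>
  Both parts come from splitting only the last block of the row. Of its four splits, three are
  horizontal: they join the left ends of the block straight to its right ends, and one of them
  leaves an extra circle behind. The remaining split is vertical: it caps off the row before it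
  on the right and, on its own right side, leaves an arc joining the ends NE and SE. So the last
  block acts as \<open>x + 2\<close> times two horizontal strands plus once the vertical pair of arcs.

  Deleting a horizontal split shortens the row by one block and keeps the kind of closure. A
  vertical split turns the closure of a chain into the closure of an \<open>n\<close>-link, because the outer
  arcs together with the remaining vertical arc now join NW to SW; this is the recurrence for the
  chain link (lemma \<open>gen_poly_chain_link_Suc\<close>). In the closure of an \<open>n\<close>-link the remaining vertical
  arc closes up to a circle of its own, so there the last block contributes the factor
  \<open>(x + 2) + x\<close> (lemma \<open>gen_poly_n_link_Suc\<close>). Hence the \<open>n\<close>-link has the polynomial
  \<open>x (2 x + 2) ^ n\<close>, and substituting this into the first recurrence gives the closed form by
  induction.

  The circles of a state are the connected components of the graph whose edges are its joints.
  Counting them needs little graph theory: an edge to a new vertex keeps the number of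
  components (\<open>components_insert_pendant\<close>), an edge disjoint from the graph adds one
  (\<open>components_insert_disjoint\<close>), and the edges may be replaced by others that force the same
  vertices to have equal colours (\<open>components_cong\<close>). With these, every state of the longer row
  is reduced to a state of the shorter row with pendant or disjoint edges in the last block.
\<close>

section \<open>Connected components of a set of edges\<close>

definition component :: "('a \<times> 'a) set \<Rightarrow> 'a \<Rightarrow> 'a set" where
  "component E a = (E \<union> E\<inverse>)\<^sup>* `` {a}"

text \<open>Only vertices on some edge count, so isolated vertices are not components.\<close>

definition components :: "('a \<times> 'a) set \<Rightarrow> nat" where
  "components E = card (component E ` Field E)"

definition edge_invariant :: "('a \<times> 'a) set \<Rightarrow> ('a \<Rightarrow> 'b) \<Rightarrow> bool" where
  "edge_invariant E f \<longleftrightarrow> (\<forall>(a, b) \<in> E. f a = f b)"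

lemma edge_invariant_empty [simp]: "edge_invariant {} f"
  by (simp add: edge_invariant_def)

lemma edge_invariant_insert [simp]:
  "edge_invariant (insert (a, b) E) f \<longleftrightarrow> f a = f b \<and> edge_invariant E f"
  by (simp add: edge_invariant_def)

lemma edge_invariant_Un [simp]:
  "edge_invariant (E \<union> F) f \<longleftrightarrow> edge_invariant E f \<and> edge_invariant F f"
  by (auto simp: edge_invariant_def)

lemma edge_invariant_cong:
  assumes "\<And>x. x \<in> Field E \<Longrightarrow> f x = g x"
  shows "edge_invariant E f \<longleftrightarrow> edge_invariant E g"
proof -
  have "f a = g a \<and> f b = g b" if "(a, b) \<in> E" for a b
    using that by (auto intro!: assms intro: FieldI1 FieldI2)
  then show ?thesis
    by (fastforce simp: edge_invariant_def)
qed

text \<open>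
  Colourings replace paths: connectedness of two vertices becomes an equational statement, in
  which edges can be exchanged by rewriting. Sets of vertices suffice as colours because the map
  sending a vertex to its component is itself an invariant colouring.
\<close>

lemma component_eq_iff:
  fixes E :: "('a \<times> 'a) set"
  shows "component E x = component E y \<longleftrightarrow>
    (\<forall>f :: 'a \<Rightarrow> 'a set. edge_invariant E f \<longrightarrow> f x = f y)"
proof
  assume "component E x = component E y"
  then have path: "(x, y) \<in> (E \<union> E\<inverse>)\<^sup>*"
    unfolding component_def by blast
  show "\<forall>f :: 'a \<Rightarrow> 'a set. edge_invariant E f \<longrightarrow> f x = f y"
  proof (intro allI impI)
    fix f :: "'a \<Rightarrow> 'a set"
    assume "edge_invariant E f"
    with path show "f x = f y"
      by (induction rule: rtrancl_induct) (auto simp: edge_invariant_def)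
  qed
next
  assume inv: "\<forall>f :: 'a \<Rightarrow> 'a set. edge_invariant E f \<longrightarrow> f x = f y"
  have sym: "sym ((E \<union> E\<inverse>)\<^sup>*)"
    by (intro sym_rtrancl) (auto simp: sym_def)
  have "component E a = component E b" if "(a, b) \<in> E" for a b
  proof -
    have path: "(a, b) \<in> (E \<union> E\<inverse>)\<^sup>*"
      using that by blast
    then have reverse_path: "(b, a) \<in> (E \<union> E\<inverse>)\<^sup>*"
      by (rule symD[OF sym])
    show ?thesis
      unfolding component_def
      using rtrancl_trans[OF path] rtrancl_trans[OF reverse_path] by blast
  qed
  then have "edge_invariant E (component E)"
    by (auto simp: edge_invariant_def)
  with inv show "component E x = component E y"
    by blast
qed

lemma card_image_eq_if_same_kernel:
  assumes "\<And>x y. x \<in> A \<Longrightarrow> y \<in> A \<Longrightarrow> f x = f y \<longleftrightarrow> g x = g y"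
  shows "card (f ` A) = card (g ` A)"
proof -
  have "bij_betw (\<lambda>z. g (inv_into A f z)) (f ` A) (g ` A)"
  proof (rule bij_betw_imageI)
    have inv: "f (inv_into A f (f x)) = f x" "inv_into A f (f x) \<in> A" if "x \<in> A" for x
      using that by (auto intro: f_inv_into_f inv_into_into)
    then show "inj_on (\<lambda>z. g (inv_into A f z)) (f ` A)"
      using assms by (intro inj_onI) (metis imageE)
    have "g (inv_into A f (f x)) = g x" if "x \<in> A" for x
      using inv[OF that] that assms by blast
    then show "(\<lambda>z. g (inv_into A f z)) ` f ` A = g ` A"
      by (auto simp: image_image)
  qed
  then show ?thesis
    by (rule bij_betw_same_card)
qed

lemma components_cong:
  fixes E F :: "('a \<times> 'a) set"
  assumes "Field E = Field F"
    and "\<And>f :: 'a \<Rightarrow> 'a set. edge_invariant E f \<longleftrightarrow> edge_invariant F f"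
  shows "components E = components F"
  unfolding components_def assms(1)
  by (rule card_image_eq_if_same_kernel) (simp add: component_eq_iff assms(2))

text \<open>
  An invariant colouring extends to vertices outside the graph in any way that suits the new
  edge, so that edge imposes nothing on the old vertices.
\<close>

lemma component_insert_eq_iff:
  assumes "b \<notin> Field E" "x \<in> Field E" "y \<in> Field E"
  shows "component (insert (a, b) E) x = component (insert (a, b) E) y \<longleftrightarrow>
    component E x = component E y"
proof
  assume "component E x = component E y"
  then show "component (insert (a, b) E) x = component (insert (a, b) E) y"
    by (simp add: component_eq_iff)
next
  assume eq: "component (insert (a, b) E) x = component (insert (a, b) E) y"
  show "component E x = component E y"
    unfolding component_eq_iff
  proof (intro allI impI)
    fix f :: "'a \<Rightarrow> 'a set"
    assume f: "edge_invariant E f"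
    have "edge_invariant E (f(b := f a)) \<longleftrightarrow> edge_invariant E f"
      using assms(1) by (intro edge_invariant_cong) auto
    with f have "edge_invariant (insert (a, b) E) (f(b := f a))"
      by simp
    with eq have "(f(b := f a)) x = (f(b := f a)) y"
      unfolding component_eq_iff by blast
    moreover have "x \<noteq> b" "y \<noteq> b"
      using assms by auto
    ultimately show "f x = f y"
      by simp
  qed
qed

lemma component_insert_edge:
  "component (insert (a, b) E) a = component (insert (a, b) E) b"
  by (simp add: component_eq_iff)

lemma components_insert_pendant:
  assumes "a \<in> Field E" "b \<notin> Field E"
  shows "components (insert (a, b) E) = components E"
proof -
  have "component (insert (a, b) E) ` Field (insert (a, b) E) =
      component (insert (a, b) E) ` Field E"
    using assms(1) component_insert_edge[of a b E] by auto
  moreover have "card (component (insert (a, b) E) ` Field E) = card (component E ` Field E)"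
    using assms(2) by (intro card_image_eq_if_same_kernel component_insert_eq_iff)
  ultimately show ?thesis
    by (simp add: components_def)
qed

lemma components_insert_disjoint:
  assumes "finite E" "a \<notin> Field E" "b \<notin> Field E"
  shows "components (insert (a, b) E) = Suc (components E)"
proof -
  let ?E = "insert (a, b) E"
  have "component ?E ` Field ?E = insert (component ?E a) (component ?E ` Field E)"
    using component_insert_edge[of a b E] by auto
  moreover have "component ?E a \<notin> component ?E ` Field E"
  proof
    let ?f = "\<lambda>z. if z \<in> Field E then {} else UNIV :: 'a set"
    assume "component ?E a \<in> component ?E ` Field E"
    then obtain x where "x \<in> Field E" and eq: "component ?E a = component ?E x"
      by blast
    have "edge_invariant E ?f \<longleftrightarrow> edge_invariant E (\<lambda>_. {} :: 'a set)"
      by (rule edge_invariant_cong) simp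
    then have "edge_invariant ?E ?f"
      using assms(2,3) by (simp add: edge_invariant_def)
    with eq have "?f a = ?f x"
      unfolding component_eq_iff by blast
    with \<open>x \<in> Field E\<close> assms(2) show False
      by simp
  qed
  moreover have "finite (component ?E ` Field E)"
    using assms(1) by (simp add: finite_Field)
  moreover have "card (component ?E ` Field E) = card (component E ` Field E)"
    using assms(3) by (intro card_image_eq_if_same_kernel component_insert_eq_iff)
  ultimately show ?thesis
    by (simp only: components_def card_insert_disjoint not_False_eq_True)
qed

section \<open>Sums over the states of a row of blocks\<close>

definition state_joints :: "'a crossing list \<Rightarrow> split_type list \<Rightarrow> ('a \<times> 'a) list" where
  "state_joints cs s = concat (map2 split_crossing s cs)"

lemma Field_set_joints: "Field (set js) = set (concat (map joint_ends js))"
  by (induction js) auto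

lemma num_circles_state_diagram:
  "num_circles (state_diagram D s) =
     components (set (joints D) \<union> set (state_joints (crossings D) s))"
proof -
  have "set (diagram_ends (state_diagram D s)) =
      Field (set (joints D) \<union> set (state_joints (crossings D) s))"
    unfolding set_append[symmetric] Field_set_joints
    by (simp add: diagram_ends_def state_diagram_def state_joints_def)
  then show ?thesis
    by (simp add: num_circles_def components_def component_def[abs_def] connected_arcs_def
        state_diagram_def state_joints_def)
qed

lemma sum_split_lists_Suc:
  fixes f :: "split_type list \<Rightarrow> 'a::comm_monoid_add"
  shows "(\<Sum>s | length s = Suc m. f s) =
    (\<Sum>s | length s = m. f (s @ [Split0]) + f (s @ [Split1]))"
proof -
  have UNIV: "(UNIV :: split_type set) = {Split0, Split1}"
    using split_type.exhaust by blast
  then have "finite (UNIV :: split_type set)"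
    by (metis finite.simps)
  have "(\<Sum>s | length s = Suc m. f s) =
      (\<Sum>(s, t) \<in> {s. length s = m} \<times> UNIV. f (s @ [t]))"
    by (rule sum.reindex_bij_witness[of _ "\<lambda>(s, t). s @ [t]" "\<lambda>s. (butlast s, last s)"])
      (auto simp: append_butlast_last_id simp flip: length_greater_0_conv)
  also have "\<dots> = (\<Sum>s | length s = m. \<Sum>t \<in> UNIV. f (s @ [t]))"
    by (simp add: sum.cartesian_product)
  finally show ?thesis
    by (simp add: UNIV)
qed

abbreviation row_crossings :: "nat \<Rightarrow> arc crossing list" where
  "row_crossings n \<equiv> crossings (block_row n)"

lemma length_row_crossings: "length (row_crossings n) = 2 * n"
  by (induction n) (auto simp: block_row_def hopf_block_def)

lemma row_crossings_Suc: "row_crossings (Suc n) = row_crossings n @ hopf_block n"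
  by (simp add: block_row_def)

lemma gen_poly_closed_row:
  "gen_poly \<lparr>crossings = row_crossings n, joints = js\<rparr> =
     (\<Sum>s | length s = 2 * n.
        monom 1 (components (set js \<union> set (state_joints (row_crossings n) s))))"
  by (simp add: gen_poly_def states_def num_circles_state_diagram length_row_crossings)

text \<open>
  The first summand is the vertical split of the last block; the other three are horizontal, and
  in the fourth \<open>Lft n\<close> and \<open>Rgt n\<close> form the extra circle.
\<close>

lemma gen_poly_closed_row_Suc:
  "gen_poly \<lparr>crossings = row_crossings (Suc n), joints = js\<rparr> =
     (\<Sum>s | length s = 2 * n.
        let J = set (state_joints (row_crossings n) s) \<union> set js in
          monom 1 (components (J \<union> {(Top n, Lft n), (Rgt n, Top (Suc n)),
                                    (Lft n, Bot n), (Bot (Suc n), Rgt n)}))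
        + monom 1 (components (J \<union> {(Top n, Lft n), (Rgt n, Top (Suc n)),
                                    (Bot n, Bot (Suc n)), (Rgt n, Lft n)}))
        + monom 1 (components (J \<union> {(Lft n, Rgt n), (Top (Suc n), Top n),
                                    (Lft n, Bot n), (Bot (Suc n), Rgt n)}))
        + monom 1 (components (J \<union> {(Lft n, Rgt n), (Top (Suc n), Top n),
                                    (Bot n, Bot (Suc n)), (Rgt n, Lft n)})))"
proof -
  have snoc: "set (state_joints (row_crossings (Suc n)) (s @ [t, u])) =
      set (state_joints (row_crossings n) s) \<union> set (state_joints (hopf_block n) [t, u])"
    if "length s = 2 * n" for s t u
    using that by (simp add: state_joints_def row_crossings_Suc length_row_crossings)
  have "gen_poly \<lparr>crossings = row_crossings (Suc n), joints = js\<rparr> =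
      (\<Sum>s | length s = Suc (Suc (2 * n)).
        monom 1 (components (set js \<union> set (state_joints (row_crossings (Suc n)) s))))"
    by (simp add: gen_poly_closed_row)
  also have "\<dots> = (\<Sum>s | length s = 2 * n. \<Sum>(t, u) \<leftarrow>
        [(Split0, Split0), (Split0, Split1), (Split1, Split0), (Split1, Split1)].
        monom 1 (components (set js \<union> set (state_joints (row_crossings (Suc n)) (s @ [t, u])))))"
    by (simp add: sum_split_lists_Suc add_ac)
  also have "\<dots> = (\<Sum>s | length s = 2 * n. \<Sum>(t, u) \<leftarrow>
        [(Split0, Split0), (Split0, Split1), (Split1, Split0), (Split1, Split1)].
        monom 1 (components (set (state_joints (row_crossings n) s) \<union> set js \<union>
          set (state_joints (hopf_block n) [t, u]))))"
    by (intro sum.cong refl) (simp add: snoc Un_ac)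
  finally show ?thesis
    by (simp add: state_joints_def hopf_block_def Let_def add_ac)
qed

definition row_arcs :: "nat \<Rightarrow> arc set" where
  "row_arcs n = Top ` {..n} \<union> Bot ` {..n} \<union> Lft ` {..<n} \<union> Rgt ` {..<n}"

lemma Field_state_joints:
  "Field (set (state_joints cs s)) \<subseteq> (\<Union>c \<in> set cs. set (crossing_ends c))"
proof -
  have "set (concat (map joint_ends (split_crossing t c))) = set (crossing_ends c)" for t c
    by (cases t; cases c) auto
  then have "Field (set (split_crossing t c)) = set (crossing_ends c)" for t c
    by (simp only: Field_set_joints)
  then show ?thesis
    by (fastforce simp: state_joints_def Field_def dest: set_zip_rightD)
qed

lemma row_crossings_ends: "(\<Union>c \<in> set (row_crossings n). set (crossing_ends c)) \<subseteq> row_arcs n"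
  by (auto simp: block_row_def hopf_block_def row_arcs_def)

lemma Field_row_state: "Field (set (state_joints (row_crossings n) s)) \<subseteq> row_arcs n"
  using Field_state_joints row_crossings_ends by (rule order_trans)

section \<open>Splitting the last block\<close>

lemma block_arcs_new:
  assumes "Field J \<subseteq> row_arcs n"
  shows "Top (Suc n) \<notin> Field J" "Bot (Suc n) \<notin> Field J"
    "Lft n \<notin> Field J" "Rgt n \<notin> Field J"
  using assms by (auto simp: row_arcs_def)

text \<open>In both closures the ends \<open>Top n\<close> and \<open>Bot n\<close> of the shorter row lie on edges of the
  closed-up graph \<open>J\<close>, so the arcs of a horizontally split last block are pendant.\<close>

lemma components_append_horizontal:
  assumes "Field J \<subseteq> row_arcs n" "Top n \<in> Field J" "Bot n \<in> Field J"
  shows "components (J \<union> {(Top n, Top (Suc n)), (Bot n, Bot (Suc n)),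
      (Top n, Lft n), (Top n, Rgt n)}) = components J"
    and "components (J \<union> {(Top n, Top (Suc n)), (Bot n, Bot (Suc n)),
      (Bot n, Lft n), (Bot n, Rgt n)}) = components J"
  using assms by (simp_all add: components_insert_pendant block_arcs_new)

lemma components_append_horizontal_circle:
  assumes "finite J" "Field J \<subseteq> row_arcs n" "Top n \<in> Field J" "Bot n \<in> Field J"
  shows "components (J \<union> {(Top n, Top (Suc n)), (Bot n, Bot (Suc n)), (Lft n, Rgt n)}) =
    Suc (components J)"
  using assms
  by (simp add: components_insert_pendant components_insert_disjoint block_arcs_new)

lemma monom_Suc_eq: "monom 1 (Suc k) = X * monom 1 k"
  by (simp add: monom_Suc)

text \<open>
  In the vertical case the outer arcs run from \<open>Top 0\<close> and \<open>Bot 0\<close> to the right ends of the last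
  block, which its right vertical arc joins; hence the edge \<open>(Top 0, Bot 0)\<close> of the closure of the
  \<open>n\<close>-link.
\<close>

lemma gen_poly_chain_link_Suc:
  "gen_poly (chain_link (Suc n)) = (X + 2) * gen_poly (chain_link n) + gen_poly (n_link n)"
proof -
  let ?R = "\<lambda>s. set (state_joints (row_crossings n) s)"
  let ?chain = "\<lambda>s. ?R s \<union> {(Top 0, Top n), (Bot 0, Bot n)}"
  let ?link = "\<lambda>s. ?R s \<union> {(Top 0, Bot 0), (Top n, Bot n)}"
  let ?J = "\<lambda>s. ?R s \<union> {(Top 0, Top (Suc n)), (Bot 0, Bot (Suc n))}"
  have chain: "Field (?chain s) \<subseteq> row_arcs n" and link: "Field (?link s) \<subseteq> row_arcs n" for s
    using Field_row_state[of n s] by (auto simp: row_arcs_def)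
  have vertical: "components (?J s \<union> {(Top n, Lft n), (Rgt n, Top (Suc n)),
      (Lft n, Bot n), (Bot (Suc n), Rgt n)}) = components (?link s)" for s
  proof -
    have "components (?J s \<union> {(Top n, Lft n), (Rgt n, Top (Suc n)),
        (Lft n, Bot n), (Bot (Suc n), Rgt n)}) =
      components (?link s \<union> {(Top 0, Top (Suc n)), (Top 0, Bot (Suc n)),
        (Top n, Lft n), (Top 0, Rgt n)})"
      by (rule components_cong) auto
    also have "\<dots> = components (?link s)"
      using block_arcs_new[OF link[of s]] by (simp add: components_insert_pendant)
    finally show ?thesis .
  qed
  have upper: "components (?J s \<union> {(Top n, Lft n), (Rgt n, Top (Suc n)),
      (Bot n, Bot (Suc n)), (Rgt n, Lft n)}) = components (?chain s)" for s
  proof -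
    have "components (?J s \<union> {(Top n, Lft n), (Rgt n, Top (Suc n)),
        (Bot n, Bot (Suc n)), (Rgt n, Lft n)}) =
      components (?chain s \<union> {(Top n, Top (Suc n)), (Bot n, Bot (Suc n)),
        (Top n, Lft n), (Top n, Rgt n)})"
      by (rule components_cong) auto
    also have "\<dots> = components (?chain s)"
      using chain[of s] by (intro components_append_horizontal(1)) auto
    finally show ?thesis .
  qed
  have lower: "components (?J s \<union> {(Lft n, Rgt n), (Top (Suc n), Top n),
      (Lft n, Bot n), (Bot (Suc n), Rgt n)}) = components (?chain s)" for s
  proof -
    have "components (?J s \<union> {(Lft n, Rgt n), (Top (Suc n), Top n),
        (Lft n, Bot n), (Bot (Suc n), Rgt n)}) =
      components (?chain s \<union> {(Top n, Top (Suc n)), (Bot n, Bot (Suc n)),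
        (Bot n, Lft n), (Bot n, Rgt n)})"
      by (rule components_cong) auto
    also have "\<dots> = components (?chain s)"
      using chain[of s] by (intro components_append_horizontal(2)) auto
    finally show ?thesis .
  qed
  have circle: "components (?J s \<union> {(Lft n, Rgt n), (Top (Suc n), Top n),
      (Bot n, Bot (Suc n)), (Rgt n, Lft n)}) = Suc (components (?chain s))" for s
  proof -
    have "components (?J s \<union> {(Lft n, Rgt n), (Top (Suc n), Top n),
        (Bot n, Bot (Suc n)), (Rgt n, Lft n)}) =
      components (?chain s \<union> {(Top n, Top (Suc n)), (Bot n, Bot (Suc n)), (Lft n, Rgt n)})"
      by (rule components_cong) auto
    also have "\<dots> = Suc (components (?chain s))"
      using chain[of s] by (intro components_append_horizontal_circle) auto
    finally show ?thesis .
  qed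
  have closure: "chain_link m = \<lparr>crossings = row_crossings m,
      joints = [(Top 0, Top m), (Bot 0, Bot m)]\<rparr>"
    "n_link m = \<lparr>crossings = row_crossings m, joints = [(Top 0, Bot 0), (Top m, Bot m)]\<rparr>" for m
    by (simp_all add: chain_link_def horizontal_closure_def n_link_def vertical_closure_def
        block_row_def)
  have "gen_poly (chain_link (Suc n)) = (\<Sum>s | length s = 2 * n.
      monom 1 (components (?link s)) + monom 1 (components (?chain s))
      + monom 1 (components (?chain s)) + X * monom 1 (components (?chain s)))"
    unfolding closure gen_poly_closed_row_Suc Let_def list.set
      vertical upper lower circle monom_Suc_eq ..
  also have "\<dots> = (\<Sum>s | length s = 2 * n.
      (X + 2) * monom 1 (components (?chain s)) + monom 1 (components (?link s)))"
    by (intro sum.cong refl) (simp only: algebra_simps mult_2)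
  finally show ?thesis
    unfolding closure gen_poly_closed_row list.set Un_commute[of "{_, _}"]
    by (simp only: sum.distrib sum_distrib_left)
qed

text \<open>
  Here \<open>Top (Suc n)\<close> and \<open>Bot (Suc n)\<close> are joined only to each other, so the right vertical arc of
  a vertical split is a new circle. The two edges at \<open>Top n\<close> and \<open>Bot n\<close> cap off the shorter row
  exactly as its own closure does.
\<close>

lemma gen_poly_n_link_Suc: "gen_poly (n_link (Suc n)) = (2 * X + 2) * gen_poly (n_link n)"
proof -
  let ?R = "\<lambda>s. set (state_joints (row_crossings n) s)"
  let ?link = "\<lambda>s. ?R s \<union> {(Top 0, Bot 0), (Top n, Bot n)}"
  let ?J = "\<lambda>s. ?R s \<union> {(Top 0, Bot 0), (Top (Suc n), Bot (Suc n))}"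
  have link: "Field (?link s) \<subseteq> row_arcs n" for s
    using Field_row_state[of n s] by (auto simp: row_arcs_def)
  have vertical: "components (?J s \<union> {(Top n, Lft n), (Rgt n, Top (Suc n)),
      (Lft n, Bot n), (Bot (Suc n), Rgt n)}) = Suc (components (?link s))" for s
  proof -
    have "components (?J s \<union> {(Top n, Lft n), (Rgt n, Top (Suc n)),
        (Lft n, Bot n), (Bot (Suc n), Rgt n)}) =
      components (?link s \<union> {(Top n, Lft n), (Top (Suc n), Rgt n), (Top (Suc n), Bot (Suc n))})"
      by (rule components_cong) auto
    also have "\<dots> = Suc (components (?link s))"
      using block_arcs_new[OF link[of s]]
      by (simp add: components_insert_pendant components_insert_disjoint)
    finally show ?thesis .
  qed
  have upper: "components (?J s \<union> {(Top n, Lft n), (Rgt n, Top (Suc n)),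
      (Bot n, Bot (Suc n)), (Rgt n, Lft n)}) = components (?link s)" for s
  proof -
    have "components (?J s \<union> {(Top n, Lft n), (Rgt n, Top (Suc n)),
        (Bot n, Bot (Suc n)), (Rgt n, Lft n)}) =
      components (?link s \<union> {(Top n, Top (Suc n)), (Bot n, Bot (Suc n)),
        (Top n, Lft n), (Top n, Rgt n)})"
      by (rule components_cong) auto
    also have "\<dots> = components (?link s)"
      using link[of s] by (intro components_append_horizontal(1)) auto
    finally show ?thesis .
  qed
  have lower: "components (?J s \<union> {(Lft n, Rgt n), (Top (Suc n), Top n),
      (Lft n, Bot n), (Bot (Suc n), Rgt n)}) = components (?link s)" for s
  proof -
    have "components (?J s \<union> {(Lft n, Rgt n), (Top (Suc n), Top n),
        (Lft n, Bot n), (Bot (Suc n), Rgt n)}) =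
      components (?link s \<union> {(Top n, Top (Suc n)), (Bot n, Bot (Suc n)),
        (Bot n, Lft n), (Bot n, Rgt n)})"
      by (rule components_cong) auto
    also have "\<dots> = components (?link s)"
      using link[of s] by (intro components_append_horizontal(2)) auto
    finally show ?thesis .
  qed
  have circle: "components (?J s \<union> {(Lft n, Rgt n), (Top (Suc n), Top n),
      (Bot n, Bot (Suc n)), (Rgt n, Lft n)}) = Suc (components (?link s))" for s
  proof -
    have "components (?J s \<union> {(Lft n, Rgt n), (Top (Suc n), Top n),
        (Bot n, Bot (Suc n)), (Rgt n, Lft n)}) =
      components (?link s \<union> {(Top n, Top (Suc n)), (Bot n, Bot (Suc n)), (Lft n, Rgt n)})"
      by (rule components_cong) auto
    also have "\<dots> = Suc (components (?link s))"
      using link[of s] by (intro components_append_horizontal_circle) auto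
    finally show ?thesis .
  qed
  have closure: "n_link m = \<lparr>crossings = row_crossings m,
      joints = [(Top 0, Bot 0), (Top m, Bot m)]\<rparr>" for m
    by (simp add: n_link_def vertical_closure_def block_row_def)
  have "gen_poly (n_link (Suc n)) = (\<Sum>s | length s = 2 * n.
      X * monom 1 (components (?link s)) + monom 1 (components (?link s))
      + monom 1 (components (?link s)) + X * monom 1 (components (?link s)))"
    unfolding closure gen_poly_closed_row_Suc Let_def list.set
      vertical upper lower circle monom_Suc_eq ..
  also have "\<dots> = (\<Sum>s | length s = 2 * n. (2 * X + 2) * monom 1 (components (?link s)))"
    by (intro sum.cong refl) (simp only: algebra_simps mult_2)
  finally show ?thesis
    unfolding closure gen_poly_closed_row list.set Un_commute[of "{_, _}"]
    by (simp only: sum_distrib_left)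
qed

section \<open>The closed forms\<close>

lemma components_singleton: "components {(a, b)} = 1"
proof -
  have "components {(a, b)} = Suc (components ({} :: ('a \<times> 'a) set))"
    by (rule components_insert_disjoint) auto
  then show ?thesis
    by (simp add: components_def)
qed

lemma gen_poly_n_link: "gen_poly (n_link n) = X * (2 * X + 2) ^ n"
proof (induction n)
  case 0
  have "gen_poly (n_link 0) = monom 1 (components {(Top 0, Bot 0)})"
    by (simp add: gen_poly_def states_def num_circles_state_diagram n_link_def
        vertical_closure_def block_row_def state_joints_def)
  then show ?case
    by (simp add: components_singleton monom_Suc)
next
  case (Suc n)
  then show ?case
    by (simp only: gen_poly_n_link_Suc power_Suc mult_ac)
qed

lemma gen_poly_chain_link_0: "gen_poly (chain_link 0) = X ^ 2"
proof -
  have "components {(Top 0, Top 0), (Bot 0, Bot 0)} = 2"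
    by (simp add: components_insert_disjoint components_singleton)
  then have "gen_poly (chain_link 0) = monom 1 2"
    by (simp add: gen_poly_def states_def num_circles_state_diagram chain_link_def
        horizontal_closure_def block_row_def state_joints_def)
  then show ?thesis
    by (simp add: monom_altdef)
qed

lemma gen_poly_chain_link:
  "gen_poly (chain_link n) = (2 * X + 2) ^ n + (X ^ 2 - 1) * (X + 2) ^ n"
proof (induction n)
  case 0
  then show ?case
    by (simp add: gen_poly_chain_link_0)
next
  case (Suc n)
  have "(X + 2) * (p + (X ^ 2 - 1) * q) + X * p = (2 * X + 2) * p + (X ^ 2 - 1) * ((X + 2) * q)"
    for p q
    by algebra
  with Suc show ?case
    by (simp only: gen_poly_chain_link_Suc gen_poly_n_link power_Suc)
qed

theorem theorem43:
  "(\<forall>n\<ge>1. gen_poly (chain_link n) =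
       (X + 2) * gen_poly (chain_link (n - 1)) + gen_poly (n_link (n - 1))) \<and>
   (\<forall>n. gen_poly (chain_link n) = (2 * X + 2) ^ n + (X ^ 2 - 1) * (X + 2) ^ n)"
proof (intro conjI allI impI)
  fix n :: nat
  assume "n \<ge> 1"
  then show "gen_poly (chain_link n) =
      (X + 2) * gen_poly (chain_link (n - 1)) + gen_poly (n_link (n - 1))"
    using gen_poly_chain_link_Suc[of "n - 1"] by simp
qed (rule gen_poly_chain_link)

end
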